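(* Let $L,n,k\in\mathbb N$ with $n\ge 5$. Let $\mathbf V\subset A_n^L$ be a set of $n+k$ words such that: (1) $\mathrm{per}(v)=|v|=L$ for all $v\in\mathbf V$; (2) $\mathrm{lexp}(uv)\le\frac{n}{n-1}$ for any two distinct $u,v\in\mathbf V$; (3) for any pairwise distinct $u,v,w\in\mathbf V$, $$\max\{\,l+r:\ \mathrm{suff}_l(u)=\mathrm{suff}_l(v),\ \mathrm{pref}_r(v)=\mathrm{pref}_r(w)\,\}\le\frac{L}{n-1}.$$ Then $f(\omega)\in\mathbf T_n$ for every infinite word $\omega\in\mathbf T_{n+k}$ and every morphism $f$ induced by a bijection $A_{n+k}\to\mathbf V$.
   Context: $\mathbb N=\{1,2,\dots\}$. $A_n=\{a_1,\dots,a_n\}$ is an alphabet of $n$ letters; $A_n^L$ is the set of words of length $L$ over $A_n$; $|v|$ is the length of $v$. A factor of a word is a block of consecutive letters. The period $\mathrm{per}(w)$ of a finite nonempty word $w$ is the least $p\ge1$ with $w(i)=w(i+p)$ for all $i=1,\dots,|w|-p$. The local exponent is $\mathrm{lexp}(w)=\sup\{|v|/\mathrm{per}(v): v \text{ a nonempty finite factor of } w\}$. For $n\ge5$, $\mathbf T_n$ is the set of (finite or infinite) words $w$ over $A_n$ all of whose nonempty finite factors $v$ satisfy $|v|/\mathrm{per}(v)\le\frac{n}{n-1}$ (threshold words). Infinite words are infinite to the right. $\mathrm{pref}_l(w)$ and $\mathrm{suff}_l(w)$ denote the prefix and the suffix of $w$ of length $l$ ($l\ge0$). The morphism $f$ replaces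 each letter of $\omega$ by its image and concatenates the images. *)

theory Defs
  imports
    Complex_Main
    "HOL-Library.Extended_Real"
    "HOL-Library.Sublist"
    "HOL-Library.Stream"
begin

datatype (letters: 'a) word = FinWord "'a list" | InfWord "'a stream"

primrec factor :: "'a list \<Rightarrow> 'a word \<Rightarrow> bool" where
  "factor v (FinWord w) \<longleftrightarrow> sublist v w"
| "factor v (InfWord s) \<longleftrightarrow> (\<exists>u t. s = u @- v @- t)"

(* Positions are counted from 0.  Meant for nonempty w. *)
definition per :: "'a list \<Rightarrow> nat" where
  "per w = (LEAST p. 1 \<le> p \<and> (\<forall>i. i + p < length w \<longrightarrow> w ! i = w ! (i + p)))"

definition exponent :: "'a list \<Rightarrow> real" where
  "exponent v = real (length v) / real (per v)"

(* Extended-real valued, because the supremum may be infinite for an infinite word. *)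
definition lexp :: "'a word \<Rightarrow> ereal" where
  "lexp w = (SUP v \<in> {v. v \<noteq> [] \<and> factor v w}. ereal (exponent v))"

(* The letter a_i is represented by its index i. *)
definition alphabet :: "nat \<Rightarrow> nat set" where
  "alphabet n = {1..n}"

definition words_of_length :: "nat \<Rightarrow> nat \<Rightarrow> nat list set" where
  "words_of_length n L = {w. set w \<subseteq> alphabet n \<and> length w = L}"

(* Used for n \<ge> 5 only. *)
definition threshold_words :: "nat \<Rightarrow> nat word set" where
  "threshold_words n =
     {w. letters w \<subseteq> alphabet n \<and>
         (\<forall>v. v \<noteq> [] \<and> factor v w \<longrightarrow> exponent v \<le> real n / (real n - 1))}"

(* pref l w and suff l w are the prefix and suffix of length l only if l \<le> length w. *)
definition pref :: "nat \<Rightarrow> 'a list \<Rightarrow> 'a list" where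
  "pref l w = take l w"

definition suff :: "nat \<Rightarrow> 'a list \<Rightarrow> 'a list" where
  "suff l w = drop (length w - l) w"

(* flat is the concatenation of the images only if these are all nonempty. *)
primrec morphism :: "('a \<Rightarrow> 'b list) \<Rightarrow> 'a word \<Rightarrow> 'b word" where
  "morphism \<phi> (FinWord w) = FinWord (concat (map \<phi> w))"
| "morphism \<phi> (InfWord s) = InfWord (flat (smap \<phi> s))"

end

theory Submission
  imports Defs
begin

text \<open>
  Bounding all exponents of an infinite word by \<open>n / (n - 1)\<close> means that a factor of length
  \<open>m\<close> which recurs at distance \<open>p\<close> satisfies \<open>(n - 1) * m \<le> p\<close>
  (\<open>threshold_words_InfWord_iff\<close>). So let a factor of \<open>f(\<omega>)\<close> of length
  \<open>m\<close> recur at distance \<open>P\<close>, and compare the positions of its two occurrences relative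
  to the blocks \<open>f(a)\<close> of length \<open>L\<close>.

  If \<open>P\<close> is not a multiple of \<open>L\<close>, the block boundaries of the two occurrences are
  shifted against each other. Were the repeated factor to contain everything between a boundary of one
  occurrence and the next boundary of the other, a proper suffix of a block would be a prefix of a
  block; this is a border of a block if the two blocks are equal, and a square inside a concatenation of
  two blocks otherwise (\<open>no_overlap\<close>). Hence at most one boundary is crossed, and the factor
  consists of one or two pieces, each of them common to two blocks (\<open>unaligned_repeat\<close>). For
  blocks of distinct letters the condition on \<open>uv\<close> bounds the pieces
  (\<open>common_factor_bound\<close>); equal letters occur in \<open>\<omega>\<close> far apart, and then
  \<open>P\<close> is large compared with \<open>m \<le> L\<close> (\<open>distant_repeat_bound\<close>); and if both
  occurrences fit into two adjacent blocks, the condition on \<open>uv\<close> applies directly.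

  If \<open>P = q * L\<close>, the repeat comes from a run of \<open>a\<close> letters of \<open>\<omega>\<close> that
  recurs at distance \<open>q\<close>, extended by a common suffix of length \<open>l\<close> of two blocks on the
  left and by a common prefix of length \<open>r\<close> on the right. As \<open>\<omega>\<close> is a threshold word
  over \<open>n + k > n\<close> letters, \<open>q \<ge> n * a\<close>, and \<open>l\<close> and \<open>r\<close> are at
  most \<open>L / (n - 1)\<close> each. Together these suffice except when \<open>a = 0\<close>, \<open>q = 1\<close>
  and when \<open>a = 1\<close>, \<open>q = n\<close>, \<open>k = 1\<close>. In these two cases the partial blocks
  belong to only three letters, and the third condition bounds \<open>l + r\<close> itself by
  \<open>L / (n - 1)\<close> (\<open>framed_run\<close>). In the second case this is because the letters of
  \<open>\<omega>\<close> are then forced (\<open>return_letter\<close>).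
\<close>

section \<open>Exponents and repeats\<close>

definition repeats :: "(nat \<Rightarrow> 'a) \<Rightarrow> nat \<Rightarrow> nat \<Rightarrow> nat \<Rightarrow> bool" where
  "repeats f p i m \<longleftrightarrow> (\<forall>j<m. f (i + j) = f (i + j + p))"

lemma repeatsD: "repeats f p i m \<Longrightarrow> i \<le> t \<Longrightarrow> t < i + m \<Longrightarrow> f t = f (t + p)"
  unfolding repeats_def by (metis le_add_diff_inverse nat_add_left_cancel_less)

lemma per_le:
  assumes "1 \<le> p" and "\<And>i. i + p < length v \<Longrightarrow> v ! i = v ! (i + p)"
  shows "per v \<le> p"
  unfolding per_def by (rule Least_le) (use assms in auto)

lemma per_properties:
  assumes "v \<noteq> []"
  shows "1 \<le> per v" "per v \<le> length v" "i + per v < length v \<Longrightarrow> v ! i = v ! (i + per v)"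
proof -
  have w: "1 \<le> length v \<and> (\<forall>i. i + length v < length v \<longrightarrow> v ! i = v ! (i + length v))"
    using assms by (cases v) auto
  have "1 \<le> per v \<and> (\<forall>i. i + per v < length v \<longrightarrow> v ! i = v ! (i + per v))"
    unfolding per_def 
    by (rule LeastI[of "\<lambda>p. 1 \<le> p \<and> (\<forall>i. i + p < length v \<longrightarrow> v ! i = v ! (i + p))"
          "length v", OF w])
  then show "1 \<le> per v" "i + per v < length v \<Longrightarrow> v ! i = v ! (i + per v)"
    by blast+
  show "per v \<le> length v" using w by (intro per_le) auto
qed

lemma exponent_le_iff:
  assumes "v \<noteq> []" and "n \<ge> 2"
  shows "exponent v \<le> real n / (real n - 1) \<longleftrightarrow> (n - 1) * (length v - per v) \<le> per v"
proof -
  define h where "h = n - 1"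
  have n: "n = Suc h" and h: "h > 0" using assms(2) by (auto simp: h_def)
  obtain m where m: "length v = per v + m"
    using per_properties(2)[OF assms(1)] le_Suc_ex by blast
  have p: "real (per v) > 0" using per_properties(1)[OF assms(1)] by simp
  have "exponent v \<le> real n / (real n - 1) \<longleftrightarrow>
      (real (per v) + real m) / real (per v) \<le> (real h + 1) / real h"
    by (simp only: exponent_def m) (simp add: n add.commute)
  also have "\<dots> \<longleftrightarrow> real h * real m \<le> real (per v)"
    using h p by (simp add: divide_simps distrib_left distrib_right mult.commute)
  also have "\<dots> \<longleftrightarrow> h * m \<le> per v"
    by (simp flip: of_nat_mult)
  also have "\<dots> \<longleftrightarrow> (n - 1) * (length v - per v) \<le> per v"
    by (simp only: m h_def add_diff_cancel_left')
  finally show ?thesis .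
qed

lemma repeat_bound_if_exponent_le:
  assumes "n \<ge> 2" and "exponent v \<le> real n / (real n - 1)" and "p \<ge> 1" and "length v = m + p"
    and "repeats ((!) v) p 0 m"
  shows "(n - 1) * m \<le> p"
proof -
  have ne: "v \<noteq> []" using assms by auto
  have "per v \<le> p"
    by (rule per_le) (use assms in \<open>auto simp: repeats_def\<close>)
  moreover have "(n - 1) * (length v - per v) \<le> per v"
    using exponent_le_iff[OF ne assms(1)] assms(2) by simp
  moreover have "(n - 1) * m \<le> (n - 1) * (length v - per v)"
    using assms(4) \<open>per v \<le> p\<close> by (intro mult_left_mono) auto
  ultimately show ?thesis by linarith
qed

lemma factor_InfWord_iff:
  "factor v (InfWord s) \<longleftrightarrow> (\<exists>i. v = map (\<lambda>j. s !! (i + j)) [0..<length v])"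
proof
  assume "factor v (InfWord s)"
  then obtain u t where s: "s = u @- v @- t" by auto
  have "v = map (\<lambda>j. s !! (length u + j)) [0..<length v]"
    by (rule nth_equalityI) (simp_all add: s)
  then show "\<exists>i. v = map (\<lambda>j. s !! (i + j)) [0..<length v]" ..
next
  assume "\<exists>i. v = map (\<lambda>j. s !! (i + j)) [0..<length v]"
  then obtain i where i: "v = map (\<lambda>j. s !! (i + j)) [0..<length v]" ..
  have "stake (length v) (sdrop i s) ! j = v ! j" if "j < length v" for j
    using that arg_cong[OF i, of "\<lambda>x. x ! j"] by (simp add: sdrop_snth)
  then have v: "stake (length v) (sdrop i s) = v"
    by (intro nth_equalityI) auto
  have "s = stake i s @- stake (length v) (sdrop i s) @- sdrop (length v) (sdrop i s)"
    by (simp only: stake_sdrop)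
  then show "factor v (InfWord s)" unfolding v factor.simps by (intro exI)
qed

text \<open>A factor of length \<open>m + p\<close> with period \<open>p\<close> is a factor of length \<open>m\<close>
  together with its recurrence at distance \<open>p\<close>, and the bound on \<open>(m + p) / p\<close> becomes
  \<open>(n - 1) * m \<le> p\<close>. Periods and quotients can be forgotten from here on.\<close>

lemma threshold_words_InfWord_iff:
  assumes "n \<ge> 2"
  shows "InfWord s \<in> threshold_words n \<longleftrightarrow> sset s \<subseteq> alphabet n \<and>
    (\<forall>p i m. p \<ge> 1 \<longrightarrow> repeats ((!!) s) p i m \<longrightarrow> (n - 1) * m \<le> p)" (is "?l \<longleftrightarrow> ?a \<and> ?r")
proof
  assume l: ?l
  have "(n - 1) * m \<le> p" if p: "p \<ge> 1" and r: "repeats ((!!) s) p i m" for p i m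
  proof -
    define v where "v = map (\<lambda>j. s !! (i + j)) [0..<m + p]"
    have len: "length v = m + p" by (simp add: v_def)
    then have "v = map (\<lambda>j. s !! (i + j)) [0..<length v]" by (simp only: v_def)
    then have "factor v (InfWord s)" unfolding factor_InfWord_iff ..
    moreover have "v \<noteq> []" using p len by auto
    ultimately have "exponent v \<le> real n / (real n - 1)"
      using l by (auto simp: threshold_words_def)
    moreover have "repeats ((!) v) p 0 m"
      unfolding repeats_def
    proof (intro allI impI)
      fix j assume j: "j < m"
      then have "s !! (i + j) = s !! (i + (j + p))" using r by (simp add: repeats_def add.assoc)
      then show "v ! (0 + j) = v ! (0 + j + p)" using j by (simp add: v_def)
    qed
    ultimately show ?thesis
      using assms p len by (intro repeat_bound_if_exponent_le[of n v])
  qed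
  then show "?a \<and> ?r" using l by (auto simp: threshold_words_def)
next
  assume r: "?a \<and> ?r"
  have "exponent v \<le> real n / (real n - 1)" if v: "v \<noteq> []" "factor v (InfWord s)" for v
  proof -
    from v(2) obtain i where i: "v = map (\<lambda>j. s !! (i + j)) [0..<length v]"
      unfolding factor_InfWord_iff ..
    have nth: "v ! j = s !! (i + j)" if "j < length v" for j
      using that arg_cong[OF i, of "\<lambda>x. x ! j"] by simp
    have "repeats ((!!) s) (per v) i (length v - per v)"
      unfolding repeats_def
    proof (intro allI impI)
      fix j assume j: "j < length v - per v"
      then have "v ! j = v ! (j + per v)" by (intro per_properties(3) v(1)) linarith
      then show "s !! (i + j) = s !! (i + j + per v)"
        using nth[of j] nth[of "j + per v"] j by (simp add: add.assoc)
    qed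
    then show ?thesis
      unfolding exponent_le_iff[OF v(1) assms] using r per_properties(1)[OF v(1)] by blast
  qed
  then show ?l using r by (auto simp: threshold_words_def)
qed

lemma repeat_bound_if_lexp_le:
  assumes "n \<ge> 2" and "lexp (FinWord x) \<le> ereal (real n / (real n - 1))"
    and "p \<ge> 1" and "i + m + p \<le> length x" and "repeats ((!) x) p i m"
  shows "(n - 1) * m \<le> p"
proof -
  define v where "v = take (m + p) (drop i x)"
  have len: "length v = m + p" using assms(4) by (simp add: v_def)
  have ne: "v \<noteq> []" using len assms(3) by auto
  have "sublist v x" unfolding v_def
    by (meson sublist_drop sublist_order.order.trans sublist_take)
  then have "ereal (exponent v) \<le> lexp (FinWord x)"
    unfolding lexp_def by (intro SUP_upper) (use ne in auto)
  then have "ereal (exponent v) \<le> ereal (real n / (real n - 1))"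
    using assms(2) by (rule order_trans)
  moreover have "repeats ((!) v) p 0 m"
    unfolding repeats_def
  proof (intro allI impI)
    fix j assume j: "j < m"
    then have "x ! (i + j) = x ! (i + (j + p))" using assms(5) by (simp add: repeats_def add.assoc)
    then show "v ! (0 + j) = v ! (0 + j + p)" using j assms(4) by (simp add: v_def)
  qed
  ultimately show ?thesis
    using assms(1,3) len by (intro repeat_bound_if_exponent_le[of n v]) auto
qed

lemma flat_smap_snth:
  assumes "\<And>x. x \<in> sset s \<Longrightarrow> length (g x) = L" and "L > 0"
  shows "flat (smap g s) !! t = g (s !! (t div L)) ! (t mod L)"
proof -
  have "flat (smap g s) !! (b * L + t) = g (s !! b) ! t" if "t < L" for b t
    using assms(1)
  proof (induction b arbitrary: s)
    case 0
    have "length (g (shd s)) = L" using 0 by (simp add: shd_sset)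
    then show ?case using that by (subst flat_unfold) (auto simp: shift_snth_less)
  next
    case (Suc b)
    have len: "length (g (shd s)) = L" using Suc.prems by (simp add: shd_sset)
    have "flat (smap g s) !! (Suc b * L + t) = flat (smap g (stl s)) !! (b * L + t)"
      using len that \<open>L > 0\<close> by (subst flat_unfold) (auto simp: shift_snth_ge)
    also have "\<dots> = g (stl s !! b) ! t"
      using Suc.prems by (intro Suc.IH) (meson stl_sset)
    finally show ?case by simp
  qed
  from this[of "t mod L" "t div L"] show ?thesis using \<open>L > 0\<close> by simp
qed

section \<open>Common factors of blocks\<close>

text \<open>Here \<open>h = n - 1\<close> and \<open>K = n + k - 1\<close>, and all conditions are stated as bounds on
  repeats. Since \<open>A\<close> has \<open>K + 1\<close> letters, \<open>letter_repeat\<close> says that \<open>w\<close>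
  is a threshold word over \<open>A\<close>.\<close>

locale threshold_substitution =
  fixes L h K :: nat and A :: "'a set" and \<phi> :: "'a \<Rightarrow> 'b list" and w :: "nat \<Rightarrow> 'a"
  assumes L_pos: "0 < L" and h_ge: "3 \<le> h" and h_less: "h < K"
    and A: "finite A" "card A = Suc K"
    and w_in [simp]: "w i \<in> A"
    and length_image [simp]: "x \<in> A \<Longrightarrow> length (\<phi> x) = L"
    and letter_repeat: "q \<ge> 1 \<Longrightarrow> repeats w q b a \<Longrightarrow> K * a \<le> q"
    and unbordered: "x \<in> A \<Longrightarrow> s \<ge> 1 \<Longrightarrow> repeats ((!) (\<phi> x)) s 0 (L - s) \<Longrightarrow> L \<le> s"
    and pair_repeat: "x \<in> A \<Longrightarrow> y \<in> A \<Longrightarrow> x \<noteq> y \<Longrightarrow> p \<ge> 1 \<Longrightarrow> i + m + p \<le> 2 * L \<Longrightarrow>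
      repeats ((!) (\<phi> x @ \<phi> y)) p i m \<Longrightarrow> h * m \<le> p"
    and triple: "x \<in> A \<Longrightarrow> y \<in> A \<Longrightarrow> z \<in> A \<Longrightarrow> x \<noteq> y \<Longrightarrow> y \<noteq> z \<Longrightarrow> x \<noteq> z \<Longrightarrow> l \<le> L \<Longrightarrow> r \<le> L \<Longrightarrow>
      (\<And>j. j < l \<Longrightarrow> \<phi> x ! (L - l + j) = \<phi> y ! (L - l + j)) \<Longrightarrow>
      (\<And>j. j < r \<Longrightarrow> \<phi> y ! j = \<phi> z ! j) \<Longrightarrow> h * (l + r) \<le> L"
begin

definition coded :: "nat \<Rightarrow> 'b" where
  "coded t = \<phi> (w (t div L)) ! (t mod L)"

definition agree :: "'a \<Rightarrow> nat \<Rightarrow> 'a \<Rightarrow> nat \<Rightarrow> nat \<Rightarrow> bool" where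
  "agree x \<alpha> y \<beta> m \<longleftrightarrow> (\<forall>j<m. \<phi> x ! (\<alpha> + j) = \<phi> y ! (\<beta> + j))"

lemma agree_sym: "agree x \<alpha> y \<beta> m \<Longrightarrow> agree y \<beta> x \<alpha> m"
  by (simp add: agree_def)

lemma coded_block: "j < L \<Longrightarrow> coded (b * L + j) = \<phi> (w b) ! j"
  using L_pos by (simp add: coded_def)

lemma agree_if_repeat:
  assumes "repeats coded P i m" and "b * L + \<alpha> = i + t" and "c * L + \<beta> = i + t + P"
    and "t + m' \<le> m" and "\<alpha> + m' \<le> L" and "\<beta> + m' \<le> L"
  shows "agree (w b) \<alpha> (w c) \<beta> m'"
  unfolding agree_def
proof (intro allI impI)
  fix j assume j: "j < m'"
  have "coded (b * L + (\<alpha> + j)) = coded (b * L + (\<alpha> + j) + P)"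
    by (rule repeatsD[OF assms(1)]) (use assms j in linarith)+
  also have "b * L + (\<alpha> + j) + P = c * L + (\<beta> + j)" using assms by linarith
  finally show "\<phi> (w b) ! (\<alpha> + j) = \<phi> (w c) ! (\<beta> + j)"
    using assms j by (simp add: coded_block)
qed

text \<open>In \<open>\<phi> x @ \<phi> y\<close> the common factor recurs at distance \<open>L + \<beta> - \<alpha>\<close>.
  Exchanging \<open>x\<close> and \<open>y\<close> gives a second bound, with the offsets in opposite roles; the
  cases below depend on choosing the right order.\<close>

lemma common_factor_bound:
  assumes "x \<in> A" "y \<in> A" "x \<noteq> y" and "agree x \<alpha> y \<beta> m" and "\<alpha> + m \<le> L" "\<beta> + m \<le> L"
  shows "h * m + \<alpha> \<le> L + \<beta>"
proof (cases "m = 0")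
  case True
  then show ?thesis using assms by simp
next
  case False
  have "repeats ((!) (\<phi> x @ \<phi> y)) (L + \<beta> - \<alpha>) \<alpha> m"
    using assms by (auto simp: repeats_def agree_def nth_append add.commute)
  then have "h * m \<le> L + \<beta> - \<alpha>"
    using assms False by (intro pair_repeat[of x y _ \<alpha>]) auto
  then show ?thesis using assms by linarith
qed

text \<open>For equal blocks a proper overlap would be a border, and for distinct blocks a square in
  \<open>\<phi> y @ \<phi> x\<close>.\<close>

lemma no_overlap:
  assumes "x \<in> A" "y \<in> A" and "agree x 0 y s (L - s)" and "0 < s"
  shows "L \<le> s"
proof (cases "x = y")
  case True
  then have "repeats ((!) (\<phi> x)) s 0 (L - s)"
    using assms by (auto simp: repeats_def agree_def add.commute)
  then show ?thesis using assms by (intro unbordered) auto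
next
  case False
  show ?thesis
  proof (rule ccontr)
    assume s: "\<not> L \<le> s"
    have "h * (L - s) + s \<le> L + 0"
      using assms False s agree_sym[OF assms(3)] by (intro common_factor_bound[of y x]) auto
    moreover have "3 * (L - s) \<le> h * (L - s)" using h_ge by (intro mult_right_mono) auto
    ultimately show False using s by linarith
  qed
qed

lemma same_letter_distance: "b < c \<Longrightarrow> w b = w c \<Longrightarrow> b + K \<le> c"
  using letter_repeat[of "c - b" b 1] by (simp add: repeats_def Suc_le_eq)

lemma adjacent_letters: "w b \<noteq> w (Suc b)"
  using same_letter_distance[of b "Suc b"] h_ge h_less by auto

text \<open>Neighbouring letters of \<open>w\<close> are distinct, so two adjacent blocks form one of the
  concatenations covered by \<open>pair_repeat\<close>.\<close>

lemma two_block_repeat: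
  assumes "repeats coded P i m" and "P \<ge> 1" and "b * L \<le> i" and "i + m + P \<le> (b + 2) * L"
  shows "h * m \<le> P"
proof -
  define \<alpha> where "\<alpha> = i - b * L"
  have i: "i = b * L + \<alpha>" and le: "\<alpha> + m + P \<le> 2 * L"
    using assms(3,4) by (auto simp: \<alpha>_def algebra_simps)
  have nth: "coded (b * L + t) = (\<phi> (w b) @ \<phi> (w (Suc b))) ! t" if "t < 2 * L" for t
  proof (cases "t < L")
    case True
    then show ?thesis by (simp add: coded_block nth_append)
  next
    case False
    then have "b * L + t = Suc b * L + (t - L)" by simp
    then show ?thesis
      using False that coded_block[of "t - L" "Suc b"] by (simp add: nth_append)
  qed
  have "repeats ((!) (\<phi> (w b) @ \<phi> (w (Suc b)))) P \<alpha> m"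
    unfolding repeats_def
  proof (intro allI impI)
    fix j assume j: "j < m"
    have "coded (b * L + (\<alpha> + j)) = coded (b * L + (\<alpha> + j + P))"
      using assms(1) j by (simp add: repeats_def i add.assoc)
    moreover have "\<alpha> + j < 2 * L" "\<alpha> + j + P < 2 * L" using le j by linarith+
    ultimately show "(\<phi> (w b) @ \<phi> (w (Suc b))) ! (\<alpha> + j)
        = (\<phi> (w b) @ \<phi> (w (Suc b))) ! (\<alpha> + j + P)"
      by (simp only: nth)
  qed
  then show ?thesis
    using assms(2) le adjacent_letters by (intro pair_repeat[of "w b" "w (Suc b)"]) auto
qed

text \<open>Used when two of the blocks involved carry the same letter. Such blocks are at least
  \<open>K > h\<close> apart, which leaves \<open>b + h < c\<close>, or only \<open>b + h \<le> c\<close> if the letter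
  belongs to block \<open>c + 1\<close>; in that case the offsets are in the favourable order.\<close>

lemma distant_repeat_bound:
  assumes "c * L + \<beta> = b * L + \<alpha> + P" and "m \<le> L"
    and "b + h < c \<and> \<alpha> \<le> L \<or> b + h \<le> c \<and> \<alpha> \<le> \<beta>"
  shows "h * m \<le> P"
proof -
  have "h * L \<le> P"
    using assms(3)
  proof
    assume a: "b + h < c \<and> \<alpha> \<le> L"
    then have "(b + h + 1) * L \<le> c * L" by (intro mult_right_mono) auto
    then show ?thesis using a assms(1) by (simp add: algebra_simps)
  next
    assume a: "b + h \<le> c \<and> \<alpha> \<le> \<beta>"
    then have "(b + h) * L \<le> c * L" by (intro mult_right_mono) auto
    then show ?thesis using a assms(1) by (simp add: algebra_simps)
  qed
  moreover have "h * m \<le> h * L" using assms(2) by simp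
  ultimately show ?thesis by linarith
qed

section \<open>Repeats with shifted block boundaries\<close>

lemma one_piece:
  assumes rep: "repeats coded P i m" and P: "P \<ge> 1"
    and i: "b * L + \<alpha> = i" and iP: "c * L + \<beta> = i + P"
    and \<alpha>: "\<alpha> + m \<le> L" and \<beta>: "\<beta> + m \<le> L" "\<beta> < L"
  shows "h * m \<le> P"
proof -
  have "b \<le> c"
  proof (rule ccontr)
    assume "\<not> b \<le> c"
    then have "Suc c * L \<le> b * L" by (intro mult_right_mono) auto
    then show False using i iP \<beta> by simp
  qed
  then consider "c = b" | "c = Suc b" | "Suc b < c" by linarith
  then show ?thesis
  proof cases
    case 1
    show ?thesis
      by (rule two_block_repeat[OF rep P, of b]) (use 1 i iP \<beta> in \<open>simp_all add: algebra_simps\<close>)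
  next
    case 2
    show ?thesis
      by (rule two_block_repeat[OF rep P, of b]) (use 2 i iP \<beta> in \<open>simp_all add: algebra_simps\<close>)
  next
    case 3
    show ?thesis
    proof (cases "w b = w c")
      case True
      then have "b + h < c" using same_letter_distance[of b c] 3 h_less by simp
      then show ?thesis using i iP \<alpha> by (intro distant_repeat_bound[of c \<beta> b \<alpha>]) auto
    next
      case False
      have "agree (w b) \<alpha> (w c) \<beta> m"
        by (rule agree_if_repeat[OF rep, of _ _ 0]) (use assms in auto)
      then have "h * m + \<alpha> \<le> L + \<beta>" using False \<alpha> \<beta> by (intro common_factor_bound) auto
      moreover have "Suc b * L \<le> c * L" using 3 by (intro mult_right_mono) auto
      ultimately show ?thesis using i iP by simp
    qed
  qed
qed

text \<open>The first occurrence crosses a boundary and the second lies inside block \<open>c\<close>. If the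
  letter of block \<open>c\<close> differs from both letters on the boundary, apply
  \<open>common_factor_bound\<close> to the left piece with block \<open>b\<close> first and to the right piece with
  block \<open>c\<close> first: the offsets cancel and the sum of the bounds is \<open>L\<close>.\<close>

lemma first_occurrence_split:
  assumes rep: "repeats coded P i m" and P: "P \<ge> 1"
    and i: "b * L + \<alpha> = i" and iP: "c * L + \<beta> = i + P"
    and \<alpha>: "\<alpha> < L" "L < \<alpha> + m" and \<beta>: "\<beta> + m \<le> L"
  shows "h * m \<le> P"
proof -
  have "b < c"
  proof (rule ccontr)
    assume "\<not> b < c"
    then have "c * L \<le> b * L" by (intro mult_right_mono) auto
    then show False using i iP \<alpha> \<beta> by linarith
  qed
  then consider "c = Suc b" | "Suc b < c" by linarith
  then show ?thesis
  proof cases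
    case 1
    show ?thesis
      by (rule two_block_repeat[OF rep P, of b]) (use 1 i iP \<beta> in \<open>simp_all add: algebra_simps\<close>)
  next
    case 2
    show ?thesis
    proof (cases "w b = w c \<or> w (Suc b) = w c")
      case True
      then have "b + h < c"
        using same_letter_distance[of b c] same_letter_distance[of "Suc b" c] 2 h_less by auto
      then show ?thesis using i iP \<alpha> \<beta> by (intro distant_repeat_bound[of c \<beta> b \<alpha>]) auto
    next
      case False
      have "agree (w b) \<alpha> (w c) \<beta> (L - \<alpha>)"
        by (rule agree_if_repeat[OF rep, of _ _ 0]) (use assms in auto)
      then have 1: "h * (L - \<alpha>) + \<alpha> \<le> L + \<beta>"
        using False \<alpha> \<beta> by (intro common_factor_bound) auto
      have "agree (w (Suc b)) 0 (w c) (\<beta> + (L - \<alpha>)) (m - (L - \<alpha>))"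
        by (rule agree_if_repeat[OF rep, of _ _ "L - \<alpha>"]) (use assms in auto)
      then have 2: "h * (m - (L - \<alpha>)) + (\<beta> + (L - \<alpha>)) \<le> L + 0"
        using False \<alpha> \<beta> by (intro common_factor_bound[of "w c" "w (Suc b)"] agree_sym[of "w (Suc b)"]) auto
      have "h * m = h * (L - \<alpha>) + h * (m - (L - \<alpha>))"
        using \<alpha> by (simp flip: distrib_left)
      moreover have "(b + 2) * L \<le> c * L" using \<open>Suc b < c\<close> by (intro mult_right_mono) auto
      ultimately show ?thesis using 1 2 i iP \<alpha> by simp
    qed
  qed
qed

lemma second_occurrence_split:
  assumes rep: "repeats coded P i m" and P: "P \<ge> 1"
    and i: "b * L + \<alpha> = i" and iP: "c * L + \<beta> = i + P"
    and \<alpha>: "\<alpha> + m \<le> L" and \<beta>: "\<beta> < L" "L < \<beta> + m"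
  shows "h * m \<le> P"
proof -
  have "b \<le> c"
  proof (rule ccontr)
    assume "\<not> b \<le> c"
    then have "Suc c * L \<le> b * L" by (intro mult_right_mono) auto
    then show False using i iP \<beta> by simp
  qed
  then consider "c = b" | "b < c" by linarith
  then show ?thesis
  proof cases
    case 1
    show ?thesis
      by (rule two_block_repeat[OF rep P, of b])
        (use 1 i iP \<alpha> \<beta> in \<open>simp_all add: algebra_simps\<close>)
  next
    case 2
    show ?thesis
    proof (cases "w b = w c \<or> w b = w (Suc c)")
      case True
      then have "b + h \<le> c"
        using same_letter_distance[of b c] same_letter_distance[of b "Suc c"] 2 h_less by auto
      then show ?thesis using i iP \<alpha> \<beta> by (intro distant_repeat_bound[of c \<beta> b \<alpha>]) auto
    next
      case False
      have "agree (w b) \<alpha> (w c) \<beta> (L - \<beta>)"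
        by (rule agree_if_repeat[OF rep, of _ _ 0]) (use assms in auto)
      then have 1: "h * (L - \<beta>) + \<beta> \<le> L + \<alpha>"
        using False \<alpha> \<beta> by (intro common_factor_bound[of "w c" "w b"] agree_sym[of "w b"]) auto
      have "agree (w b) (\<alpha> + (L - \<beta>)) (w (Suc c)) 0 (m - (L - \<beta>))"
        by (rule agree_if_repeat[OF rep, of _ _ "L - \<beta>"]) (use assms in auto)
      then have 2: "h * (m - (L - \<beta>)) + (\<alpha> + (L - \<beta>)) \<le> L + 0"
        using False \<alpha> \<beta> by (intro common_factor_bound) auto
      have "h * m = h * (L - \<beta>) + h * (m - (L - \<beta>))"
        using \<beta> by (simp flip: distrib_left)
      moreover have "Suc b * L \<le> c * L" using \<open>b < c\<close> by (intro mult_right_mono) auto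
      ultimately show ?thesis using 1 2 i iP \<alpha> \<beta> by simp
    qed
  qed
qed

text \<open>The boundary that comes first belongs to the occurrence with the larger offset. Reaching the
  next boundary, which belongs to the other occurrence, is impossible by \<open>no_overlap\<close>, so the
  occurrence with the smaller offset stays inside its block.\<close>

lemma unaligned_repeat:
  assumes rep: "repeats coded P i m" and P: "P \<ge> 1"
    and i: "b * L + \<alpha> = i" and iP: "c * L + \<beta> = i + P"
    and \<alpha>: "\<alpha> < L" and \<beta>: "\<beta> < L" and "\<alpha> \<noteq> \<beta>"
  shows "h * m \<le> P"
proof (cases "\<alpha> < \<beta>")
  case True
  have "\<alpha> + m \<le> L"
  proof (rule ccontr)
    assume m: "\<not> \<alpha> + m \<le> L"
    have "agree (w b) (\<alpha> + (L - \<beta>)) (w (Suc c)) 0 (L - (\<alpha> + (L - \<beta>)))"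
      by (rule agree_if_repeat[OF rep, of _ _ "L - \<beta>"]) (use True m assms in auto)
    then have "L \<le> \<alpha> + (L - \<beta>)"
      using \<beta> by (intro no_overlap[of "w (Suc c)" "w b"] agree_sym[of "w b"]) auto
    then show False using True \<beta> by linarith
  qed
  then show ?thesis
    using one_piece[OF rep P i iP] second_occurrence_split[OF rep P i iP] \<beta> by linarith
next
  case False
  have "\<beta> + m \<le> L"
  proof (rule ccontr)
    assume m: "\<not> \<beta> + m \<le> L"
    have "agree (w (Suc b)) 0 (w c) (\<beta> + (L - \<alpha>)) (L - (\<beta> + (L - \<alpha>)))"
      by (rule agree_if_repeat[OF rep, of _ _ "L - \<alpha>"]) (use False m assms in auto)
    then have "L \<le> \<beta> + (L - \<alpha>)"
      using \<alpha> by (intro no_overlap[of "w (Suc b)" "w c"]) auto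
    then show False using False assms by linarith
  qed
  then show ?thesis
    using one_piece[OF rep P i iP] first_occurrence_split[OF rep P i iP] \<alpha> \<beta> by linarith
qed

section \<open>Repeats with aligned block boundaries\<close>

lemma distinct_agree_length:
  assumes "x \<in> A" "y \<in> A" "x \<noteq> y" and "agree x \<alpha> y \<alpha> m" and "\<alpha> + m \<le> L"
  shows "h * m \<le> L"
  using common_factor_bound[OF assms(1-4)] assms(5) by simp

lemma triple_agree:
  assumes "x \<in> A" "y \<in> A" "z \<in> A" "x \<noteq> y" "y \<noteq> z" "x \<noteq> z" and "l \<le> L" "r \<le> L"
    and "agree x (L - l) y (L - l) l" and "agree y 0 z 0 r"
  shows "h * (l + r) \<le> L"
  by (rule triple[OF assms(1-8)]) (use assms(9,10) in \<open>simp_all add: agree_def\<close>)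

text \<open>Any \<open>K\<close> consecutive letters of \<open>w\<close> are distinct, so \<open>w b, \<dots>, w (b + K)\<close>
  exhaust the \<open>K + 1\<close> letters. Each of them except \<open>w b\<close>, \<open>w (b + 1)\<close> and
  \<open>w (b + 2)\<close> occurs too recently to be \<open>w (b + K + 2)\<close>; the hypotheses exclude the last
  two.\<close>

lemma return_letter:
  assumes "w (Suc b) = w (Suc b + K)" and "w b \<noteq> w (b + K)" and "w (b + 2) \<noteq> w (b + 2 + K)"
  shows "w (b + K + 2) = w b"
proof -
  have "inj_on w {b..b + K}"
  proof (rule inj_onI)
    have *: "i = j" if "i \<in> {b..b + K}" "j \<in> {b..b + K}" "w i = w j" "i \<le> j" for i j
    proof (rule ccontr)
      assume "i \<noteq> j"
      then have "i + K \<le> j" using that same_letter_distance by simp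
      then have "i = b" "j = b + K" using that by auto
      then show False using that assms(2) by simp
    qed
    show "i = j" if "i \<in> {b..b + K}" "j \<in> {b..b + K}" "w i = w j" for i j
      using *[OF that] *[OF that(2,1) that(3)[symmetric]] by linarith
  qed
  then have "card (w ` {b..b + K}) = card A" using A by (simp add: card_image)
  then have "w ` {b..b + K} = A" using A by (intro card_subset_eq) auto
  then have "w (b + K + 2) \<in> w ` {b..b + K}" by simp
  then obtain j where j: "b \<le> j" "j \<le> b + K" "w j = w (b + K + 2)" by auto
  then have "j + K \<le> b + K + 2" by (intro same_letter_distance) auto
  then consider "j = b" | "j = Suc b" | "j = b + 2" using j(1) by linarith
  then show ?thesis
  proof cases
    case 2
    then show ?thesis using j(3) assms(1) adjacent_letters[of "Suc b + K"] by simp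
  qed (use j(3) assms(3) in \<open>auto simp: add.commute add.left_commute\<close>)
qed

text \<open>The bounds \<open>h * l \<le> L\<close> and \<open>h * r \<le> L\<close> settle the claim when
  \<open>h * a + 2 \<le> q\<close>. By \<open>K * a \<le> q\<close> and \<open>h < K\<close> this leaves two cases:
  \<open>a = 0\<close>, \<open>q = 1\<close>, and \<open>a = 1\<close>, \<open>q = K = h + 1\<close>. There
  \<open>h * a + 1 \<le> q\<close>, so \<open>h * (l + r) \<le> L\<close> is enough, and that follows from
  \<open>triple\<close> because two of the four letters bordering the two runs coincide: for
  \<open>a = 0\<close> the letters \<open>w (b + 1)\<close> and \<open>w (b + q)\<close> are the same one, for
  \<open>a = 1\<close> use \<open>return_letter\<close>.\<close>

lemma framed_run:
  assumes q: "q \<ge> 1" and l: "l \<le> L" and r: "r \<le> L"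
    and run: "repeats w q (Suc b) a"
    and left: "w b \<noteq> w (b + q)" "agree (w b) (L - l) (w (b + q)) (L - l) l"
    and right: "w (b + a + 1) \<noteq> w (b + a + 1 + q)"
      "agree (w (b + a + 1)) 0 (w (b + a + 1 + q)) 0 r"
  shows "h * (l + a * L + r) \<le> q * L"
proof -
  have a: "K * a \<le> q" using q run by (rule letter_repeat)
  have hl: "h * l \<le> L" using left l by (intro distinct_agree_length[of "w b" "w (b + q)" "L - l"]) auto
  have hr: "h * r \<le> L"
    using right r by (intro distinct_agree_length[of "w (b + a + 1)" "w (b + a + 1 + q)" 0]) auto
  have split: "h * (l + a * L + r) = h * l + h * r + (h * a) * L"
    by (simp add: algebra_simps)
  have enough: ?thesis if "h * a + 2 \<le> q"
  proof -
    have "(h * a + 2) * L \<le> q * L" using that by (intro mult_right_mono) auto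
    then have "(h * a) * L + 2 * L \<le> q * L" by (simp add: distrib_right)
    then show ?thesis unfolding split using hl hr by linarith
  qed
  have tight: ?thesis if "h * (l + r) \<le> L" "h * a + 1 \<le> q"
  proof -
    have "(h * a + 1) * L \<le> q * L" using that by (intro mult_right_mono) auto
    then have "(h * a) * L + L \<le> q * L" by (simp add: distrib_right)
    then show ?thesis unfolding split using that by (simp add: distrib_left)
  qed
  have "(h + 1) * a \<le> K * a" using h_less by (intro mult_right_mono) auto
  then have ha: "h * a + a \<le> q" using a by simp
  consider "a \<ge> 2" | "a = 1" "q \<ge> h + 2" | "a = 1" "q = K" "q = h + 1"
    | "a = 0" "q \<ge> 2" | "a = 0" "q = 1"
  proof -
    consider "a \<ge> 2" | "a = 1" | "a = 0" by linarith
    then show ?thesis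
    proof cases
      case 2
      then have "K \<le> q" using a by simp
      then show ?thesis using that(2,3) 2 h_less by linarith
    qed (use that q in linarith)+
  qed
  then show ?thesis
  proof cases
    case 1
    then show ?thesis using enough ha by linarith
  next
    case 2
    then show ?thesis using enough by simp
  next
    case 3
    have "w (b + K + 2) = w b"
      using run left(1) right(1) 3
      by (intro return_letter) (auto simp: repeats_def)
    then have eq: "w (b + 2 + K) = w b" by (simp add: add.commute add.left_commute)
    have ne: "w (b + K) \<noteq> w (b + 2)"
      using same_letter_distance[of "b + 2" "b + K"] 3 h_ge by auto
    have "agree (w (b + K)) (L - l) (w b) (L - l) l" "agree (w b) 0 (w (b + 2)) 0 r"
      using left(2) right(2) 3 eq by (auto intro: agree_sym)
    then have "h * (l + r) \<le> L"
      using l r left(1) right(1) 3 eq ne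
      by (intro triple_agree[of "w (b + K)" "w b" "w (b + 2)"]) auto
    then show ?thesis using tight 3 by simp
  next
    case 4
    then show ?thesis using enough by simp
  next
    case 5
    have "w b \<noteq> w (b + 2)" using same_letter_distance[of b "b + 2"] h_ge h_less by auto
    then have "h * (l + r) \<le> L"
      using l r left right 5
      by (intro triple_agree[of "w b" "w (b + 1)" "w (b + 2)"]) auto
    then show ?thesis using tight 5 by simp
  qed
qed

text \<open>With a partial block on one side only, \<open>K * a \<le> q\<close> alone suffices: since
  \<open>h < K\<close>, it leaves room for one additional \<open>L\<close>.\<close>

lemma half_framed_run:
  assumes q: "q \<ge> 1" and run: "repeats w q b a" and a: "a \<ge> 1" and l: "h * l \<le> L"
  shows "h * (l + a * L) \<le> q * L"
proof -
  have "(h + 1) * a \<le> K * a" using h_less by (intro mult_right_mono) auto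
  also have "K * a \<le> q" using q run by (rule letter_repeat)
  finally have "h * a + 1 \<le> q" using a by simp
  then have "(h * a + 1) * L \<le> q * L" by (intro mult_right_mono) auto
  then show ?thesis using l by (simp add: algebra_simps)
qed

text \<open>Blocks met completely carry equal letters, since the images of distinct letters cannot agree
  on \<open>L\<close> positions. An end block met partially may also carry equal letters; it then counts as part
  of the run, at full length, which only enlarges the bound to be shown.\<close>

lemma aligned_repeat:
  assumes rep: "repeats coded P i m" and P: "P \<ge> 1"
    and i: "b * L + \<alpha> = i" and iP: "c * L + \<alpha> = i + P" and \<alpha>: "\<alpha> < L"
  shows "h * m \<le> P"
proof (cases "\<alpha> + m \<le> L")
  case True
  then show ?thesis using one_piece[OF rep P i iP] \<alpha> by simp
next
  case False
  have "b < c"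
  proof (rule ccontr)
    assume "\<not> b < c"
    then have "c * L \<le> b * L" by (intro mult_right_mono) auto
    then show False using i iP P by linarith
  qed
  define q where "q = c - b"
  have q: "q \<ge> 1" and c: "c = b + q" using \<open>b < c\<close> by (auto simp: q_def)
  have PqL: "P = q * L" using i iP by (simp add: c algebra_simps)
  define l where "l = L - \<alpha>"
  \<comment> \<open>Subtracting 1 makes \<open>r\<close> range over \<open>1, \<dots>, L\<close>, so a complete last block is
    counted in \<open>r\<close> and not in \<open>a\<close>.\<close>
  define a where "a = (m - l - 1) div L"
  define r where "r = Suc ((m - l - 1) mod L)"
  have l: "0 < l" "l \<le> L" "L - l = \<alpha>" using \<alpha> by (auto simp: l_def)
  have r: "r \<le> L" using L_pos by (simp add: r_def Suc_le_eq)
  have "a * L + (r - 1) = m - l - 1" unfolding a_def r_def by simp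
  then have m: "m = l + a * L + r" using False l by (auto simp: r_def)
  have agree: "agree (w b') \<beta> (w (b' + q)) \<beta> k"
    if "b' * L + \<beta> = i + t" "t + k \<le> m" "\<beta> + k \<le> L" for b' \<beta> t k
    by (rule agree_if_repeat[OF rep that(1) _ that(2,3,3)])
      (use that(1) PqL in \<open>simp add: distrib_right\<close>)
  have start: "(b + d + 1) * L = i + (l + d * L)" for d
    using i l by (simp add: algebra_simps)
  have left: "agree (w b) (L - l) (w (b + q)) (L - l) l"
    by (rule agree[of _ _ 0]) (use i l m in auto)
  have right: "agree (w (b + a + 1)) 0 (w (b + a + 1 + q)) 0 r"
    by (rule agree[of _ _ "l + a * L"]) (use start[of a] m r in auto)
  have mid: "w (b + d + 1) = w (b + d + 1 + q)" if "d < a" for d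
  proof (rule ccontr)
    assume ne: "w (b + d + 1) \<noteq> w (b + d + 1 + q)"
    have "(d + 1) * L \<le> a * L" using that by (intro mult_right_mono) auto
    then have "agree (w (b + d + 1)) 0 (w (b + d + 1 + q)) 0 L"
      by (intro agree[of _ _ "l + d * L"]) (use start[of d] m in auto)
    then have "h * L \<le> L" using ne by (intro distinct_agree_length[of "w (b + d + 1)" "w (b + d + 1 + q)" 0]) auto
    then show False using L_pos h_ge by simp
  qed
  then have run: "repeats w q (Suc b) a" by (simp add: repeats_def add.commute add.left_commute)
  show ?thesis
  proof (cases "w b = w (b + q)")
    case True
    have run': "repeats w q b (Suc a)"
      using True run unfolding repeats_def by (auto simp: less_Suc_eq_0_disj)
    show ?thesis
    proof (cases "w (b + a + 1) = w (b + a + 1 + q)")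
      case True
      have "repeats w q b (a + 2)"
        using True run' unfolding repeats_def by (auto simp: less_Suc_eq)
      then have "h * (0 + (a + 2) * L) \<le> q * L" using q by (intro half_framed_run) auto
      moreover have "h * m \<le> h * (0 + (a + 2) * L)"
        unfolding m using l r by (intro mult_left_mono) auto
      ultimately show ?thesis unfolding PqL by (rule order_trans[rotated])
    next
      case False
      then have "h * r \<le> L"
        using right r
        by (intro distinct_agree_length[of "w (b + a + 1)" "w (b + a + 1 + q)" 0]) auto
      then have "h * (r + Suc a * L) \<le> q * L" using q run' by (intro half_framed_run) auto
      moreover have "h * m \<le> h * (r + Suc a * L)"
        unfolding m using l by (intro mult_left_mono) auto
      ultimately show ?thesis unfolding PqL by (rule order_trans[rotated])
    qed
  next
    case ne: False
    have hl: "h * l \<le> L"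
      using left l ne by (intro distinct_agree_length[of "w b" "w (b + q)" "L - l"]) auto
    show ?thesis
    proof (cases "w (b + a + 1) = w (b + a + 1 + q)")
      case True
      have "repeats w q (Suc b) (Suc a)"
        using True run unfolding repeats_def by (auto simp: less_Suc_eq)
      then have "h * (l + Suc a * L) \<le> q * L" using q hl by (intro half_framed_run) auto
      moreover have "h * m \<le> h * (l + Suc a * L)"
        unfolding m using r by (intro mult_left_mono) auto
      ultimately show ?thesis unfolding PqL by (rule order_trans[rotated])
    next
      case False
      then show ?thesis
        unfolding PqL m using q l(2) r run ne left right by (intro framed_run)
    qed
  qed
qed

lemma coded_repeat_bound:
  assumes "repeats coded P i m" and "P \<ge> 1"
  shows "h * m \<le> P"
proof (cases "i mod L = (i + P) mod L")
  case True
  show ?thesis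
    by (rule aligned_repeat[OF assms, of "i div L" "i mod L" "(i + P) div L"])
      (use L_pos in \<open>simp_all add: True\<close>, simp flip: True)
next
  case False
  then show ?thesis
    using L_pos
    by (intro unaligned_repeat[OF assms, of "i div L" "i mod L" "(i + P) div L" "(i + P) mod L"])
      auto
qed

end

section \<open>Images of threshold words\<close>

theorem mainTheorem1:
  fixes L n k :: nat and V :: "nat list set"
    and \<phi> :: "nat \<Rightarrow> nat list" and \<omega> :: "nat stream"
  assumes "L \<ge> 1" and "n \<ge> 5" and "k \<ge> 1"
    and "V \<subseteq> words_of_length n L" and "card V = n + k"
    and "\<And>v. v \<in> V \<Longrightarrow> per v = length v \<and> length v = L"
    and "\<And>u v. u \<in> V \<Longrightarrow> v \<in> V \<Longrightarrow> u \<noteq> v \<Longrightarrow>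
           lexp (FinWord (u @ v)) \<le> ereal (real n / (real n - 1))"
    and "\<And>u v w. u \<in> V \<Longrightarrow> v \<in> V \<Longrightarrow> w \<in> V \<Longrightarrow> u \<noteq> v \<Longrightarrow> v \<noteq> w \<Longrightarrow> u \<noteq> w \<Longrightarrow>
           real (Max {l + r | l r. l \<le> L \<and> r \<le> L \<and>
                        suff l u = suff l v \<and> pref r v = pref r w})
             \<le> real L / (real n - 1)"
    and "bij_betw \<phi> (alphabet (n + k)) V"
    and "InfWord \<omega> \<in> threshold_words (n + k)"
  shows "morphism \<phi> (InfWord \<omega>) \<in> threshold_words n"
proof -
  let ?A = "alphabet (n + k)"
  have \<omega>: "sset \<omega> \<subseteq> ?A"
    and \<omega>_rep: "\<And>p i m. p \<ge> 1 \<Longrightarrow> repeats ((!!) \<omega>) p i m \<Longrightarrow> (n + k - 1) * m \<le> p"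
    using assms(2,10) by (simp_all add: threshold_words_InfWord_iff)
  have V: "\<phi> x \<in> V" if "x \<in> ?A" for x
    using that assms(9) by (auto simp: bij_betw_def)
  have neq: "\<phi> x \<noteq> \<phi> y" if "x \<in> ?A" "y \<in> ?A" "x \<noteq> y" for x y
    using that assms(9) by (auto simp: bij_betw_def inj_on_def)
  have len: "length (\<phi> x) = L" if "x \<in> ?A" for x
    using V[OF that] assms(6) by blast
  interpret threshold_substitution L "n - 1" "n + k - 1" ?A \<phi> "\<lambda>i. \<omega> !! i"
  proof
    show "\<omega> !! i \<in> ?A" for i using \<omega> snth_sset by blast
    show "(n + k - 1) * a \<le> q" if "q \<ge> 1" "repeats (\<lambda>i. \<omega> !! i) q b a" for q b a
      using that by (intro \<omega>_rep) simp_all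
    show "L \<le> s" if "x \<in> ?A" "s \<ge> 1" "repeats ((!) (\<phi> x)) s 0 (L - s)" for x s
    proof -
      have "per (\<phi> x) \<le> s"
        by (rule per_le) (use that len in \<open>simp_all add: repeats_def less_diff_conv\<close>)
      then show ?thesis using assms(6) V that(1) by metis
    qed
    show "(n - 1) * m \<le> p"
      if "x \<in> ?A" "y \<in> ?A" "x \<noteq> y" "p \<ge> 1" "i + m + p \<le> 2 * L"
        "repeats ((!) (\<phi> x @ \<phi> y)) p i m" for x y p i m
      using assms(2) that assms(7)[OF V V neq] len
      by (intro repeat_bound_if_lexp_le[of n "\<phi> x @ \<phi> y" p i m]) simp_all
    show "(n - 1) * (l + r) \<le> L"
      if A: "x \<in> ?A" "y \<in> ?A" "z \<in> ?A" "x \<noteq> y" "y \<noteq> z" "x \<noteq> z" and lr: "l \<le> L" "r \<le> L"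
        and l: "\<And>j. j < l \<Longrightarrow> \<phi> x ! (L - l + j) = \<phi> y ! (L - l + j)"
        and r: "\<And>j. j < r \<Longrightarrow> \<phi> y ! j = \<phi> z ! j" for x y z l r
    proof -
      let ?M = "{l + r | l r. l \<le> L \<and> r \<le> L \<and> suff l (\<phi> x) = suff l (\<phi> y) \<and>
        pref r (\<phi> y) = pref r (\<phi> z)}"
      have "suff l (\<phi> x) = suff l (\<phi> y)"
        using A lr l by (intro nth_equalityI) (simp_all add: suff_def len)
      moreover have "pref r (\<phi> y) = pref r (\<phi> z)"
        using A lr r by (intro nth_equalityI) (simp_all add: pref_def len)
      ultimately have "l + r \<in> ?M" using lr by blast
      moreover have "finite ?M" by (rule finite_subset[of _ "{..2 * L}"]) auto
      ultimately have "real (l + r) \<le> real (Max ?M)" by (simp del: of_nat_add)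
      also have "\<dots> \<le> real L / (real n - 1)"
        using A by (intro assms(8) V neq)
      finally have "real (n - 1) * real (l + r) \<le> real L"
        using assms(2) by (simp add: field_simps of_nat_diff)
      then show ?thesis by (simp only: of_nat_le_iff flip: of_nat_mult)
    qed
  qed (use assms(1-3) len in \<open>simp_all add: alphabet_def\<close>)
  have im: "flat (smap \<phi> \<omega>) !! t = coded t" for t
    unfolding coded_def using \<omega> len L_pos by (intro flat_smap_snth) auto
  have "sset (flat (smap \<phi> \<omega>)) \<subseteq> alphabet n"
  proof -
    have "coded t \<in> alphabet n" for t
    proof -
      have "\<phi> (\<omega> !! (t div L)) \<in> words_of_length n L" using V[OF w_in] assms(4) by blast
      then show ?thesis
        unfolding coded_def words_of_length_def using L_pos by (auto dest: nth_mem)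
    qed
    then show ?thesis by (auto simp: sset_range im)
  qed
  moreover have "(!!) (flat (smap \<phi> \<omega>)) = coded" using im by blast
  ultimately show ?thesis
    using assms(2) coded_repeat_bound by (simp add: threshold_words_InfWord_iff)
qed

end
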